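(* For the polynomial $1+x+y$ in the two variables $x,y$, $$c(1+x+y)=\frac{1}{3}.$$
   Context: For a polynomial $P(x,y)\in\mathbb{C}[x,y]$ of degree $g\ge 1$ in $y$, the alternative Mahler measure of $P$ is $$c(P(x,y)):=\frac{1}{g}\int_0^1\int_0^1\frac{\frac{\partial P}{\partial y}(e^{2\pi i t},e^{2\pi i s})\,e^{2\pi i s}}{P(e^{2\pi i t},e^{2\pi i s})}\,dt\,ds,$$ where the integral is a Lebesgue integral over $[0,1]^2$ (the integrand need only be defined almost everywhere and integrable). In particular $c(1+x+y)=\int_0^1\int_0^1 \frac{e^{2\pi i s}}{1+e^{2\pi i t}+e^{2\pi i s}}\,dt\,ds$. *)

theory Defs
  imports "HOL-Analysis.Analysis" "HOL-Computational_Algebra.Polynomial"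
begin

text \<open>
  An element of \<open>\<complex>[x, y]\<close> is an element of \<open>\<complex>[x][y]\<close>, a polynomial in \<open>y\<close> whose coefficients are
  polynomials in \<open>x\<close>. Hence \<^const>\<open>degree\<close> is the degree in \<open>y\<close> and \<^const>\<open>pderiv\<close> is the
  partial derivative with respect to \<open>y\<close>.
\<close>

definition poly_x :: "complex poly poly" where
  "poly_x = [:[:0, 1:]:]"

definition poly_y :: "complex poly poly" where
  "poly_y = [:0, 1:]"

text \<open>The inner evaluation substitutes the constant \<open>b\<close> for \<open>y\<close>, leaving a polynomial in \<open>x\<close>.\<close>

definition eval2 :: "complex poly poly \<Rightarrow> complex \<Rightarrow> complex \<Rightarrow> complex" where
  "eval2 P a b = poly (poly P [:b:]) a"

lemma eval2_poly_x [simp]: "eval2 poly_x a b = a"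
  by (simp add: eval2_def poly_x_def)

lemma eval2_poly_y [simp]: "eval2 poly_y a b = b"
  by (simp add: eval2_def poly_y_def)

lemma eval2_1 [simp]: "eval2 1 a b = 1"
  by (simp add: eval2_def)

lemma eval2_add [simp]: "eval2 (P + Q) a b = eval2 P a b + eval2 Q a b"
  by (simp add: eval2_def)

lemma eval2_mult [simp]: "eval2 (P * Q) a b = eval2 P a b * eval2 Q a b"
  by (simp add: eval2_def)

text \<open>
  Meaningful for \<open>degree P \<ge> 1\<close>. Then the zeros of the denominator on the torus form a null set, so
  the convention \<open>z / 0 = 0\<close> is harmless. The integral of a non-integrable function is \<open>0\<close>, so a
  nonzero value of \<open>alt_mahler P\<close> entails integrability.
\<close>

definition alt_mahler_integrand :: "complex poly poly \<Rightarrow> real \<times> real \<Rightarrow> complex" where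
  "alt_mahler_integrand P = (\<lambda>(t, s).
     eval2 (pderiv P) (exp (2 * of_real pi * \<i> * of_real t)) (exp (2 * of_real pi * \<i> * of_real s))
       * exp (2 * of_real pi * \<i> * of_real s)
     / eval2 P (exp (2 * of_real pi * \<i> * of_real t)) (exp (2 * of_real pi * \<i> * of_real s)))"

definition alt_mahler :: "complex poly poly \<Rightarrow> complex" where
  "alt_mahler P =
     1 / of_nat (degree P) * (LINT z:{0..1} \<times> {0..1}|lborel. alt_mahler_integrand P z)"

end

theory Submission
  imports Defs
begin

text \<open>
  Write \<open>z\<close>, \<open>w\<close> for the two coordinates of the torus. The automorphism \<open>(z, w) \<mapsto> (1 / z, w / z)\<close>
  turns \<open>z / (1 + z + w)\<close> into \<open>1 / (1 + z + w)\<close>, and swapping the coordinates exchanges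
  \<open>z / (1 + z + w)\<close> and \<open>w / (1 + z + w)\<close>. Hence these three functions have the same integral,
  and as they add up to 1, it is \<open>1 / 3\<close>.

  For integrability, \<open>\<bar>1 + z + w\<bar>\<close> is at least \<open>\<bar>\<bar>1 + z\<bar> - 1\<bar>\<close> and at least \<open>\<bar>\<bar>1 + w\<bar> - 1\<bar>\<close>, hence
  at least their geometric mean. This bounds \<open>1 / \<bar>1 + z + w\<bar>\<close> by a product of two functions of one
  variable, whose only singularities on \<open>[0, 1]\<close> are of the type \<open>\<bar>t - a\<bar> powr (- 1 / 2)\<close>
  with \<open>a = 1 / 3\<close> or \<open>a = 2 / 3\<close>.
\<close>

section \<open>Inverse square root singularities on the line\<close>

lemma integrable_inverse_sqrt_abs:
  fixes c :: real
  shows "set_integrable lborel {-c..c} (\<lambda>x. 1 / sqrt \<bar>x\<bar>)"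
proof (cases "c \<ge> 0")
  case True
  have "(\<lambda>x::real. x powr (-1/2)) absolutely_integrable_on {0..c}"
    using integrable_on_powr_from_0[of "-1/2" c] True
    by (intro nonnegative_absolutely_integrable_1) auto
  \<comment> \<open>\<open>absolutely_integrable_on\<close> refers to the completion of
    \<open>lborel\<close>; Borel measurability of the integrand allows the return to
    \<open>lborel\<close> itself.\<close>
  then have p: "set_integrable lborel {0..c} (\<lambda>x. x powr (-1/2))"
    by (simp add: set_integrable_def integrable_completion)
  have pos: "set_integrable lborel {0..c} (\<lambda>x. 1 / sqrt \<bar>x\<bar>)"
    by (rule set_integrable_cong[THEN iffD1, OF refl refl _ p])
       (auto simp: powr_minus_divide powr_half_sqrt)
  have "integrable lborel (\<lambda>x. indicator {0..c} (0 + (-1) * x) *\<^sub>R (1 / sqrt \<bar>0 + (-1) * x\<bar>))"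
    using pos unfolding set_integrable_def by (rule lborel_integrable_real_affine) simp
  moreover have "indicator {0..c} (- x) = (indicator {-c..0} x :: real)" for x
    by (auto simp: indicator_def)
  ultimately have neg: "set_integrable lborel {-c..0} (\<lambda>x. 1 / sqrt \<bar>x\<bar>)"
    by (simp add: set_integrable_def)
  have "{-c..c} = {-c..0} \<union> {0..c}"
    using True by auto
  then show ?thesis
    using set_integrable_Un[OF neg pos] by simp
qed (simp add: set_integrable_def)

lemma integrable_inverse_sqrt_dist:
  assumes "0 \<le> a" "a \<le> 1"
  shows "set_integrable lborel {0..1} (\<lambda>x::real. 1 / sqrt \<bar>x - a\<bar>)"
proof -
  have "integrable lborel (\<lambda>x. indicator {-1..1} (-a + 1 * x) *\<^sub>R (1 / sqrt \<bar>-a + 1 * x\<bar>))"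
    using integrable_inverse_sqrt_abs[of 1] unfolding set_integrable_def
    by (rule lborel_integrable_real_affine) simp
  moreover have "indicator {-1..1} (-a + x) = (indicator {a-1..a+1} x :: real)" for x
    by (auto simp: indicator_def)
  ultimately have "set_integrable lborel {a-1..a+1} (\<lambda>x. 1 / sqrt \<bar>x - a\<bar>)"
    by (simp add: set_integrable_def)
  then show ?thesis
    by (rule set_integrable_subset) (use assms in auto)
qed

section \<open>Integrals of functions of period 1\<close>

text \<open>Cut [0, 1] at \<open>a\<close>. Translation takes [a, 1] to [0, 1 - a], and translation
  followed by one period takes [0, a] to [1 - a, 1]. The pieces overlap in single points, which are
  null.\<close>

lemma
  fixes f :: "real \<Rightarrow> 'a :: {banach, second_countable_topology}"
  assumes per: "\<And>x. f (x + 1) = f x"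
    and a: "0 \<le> a" "a \<le> 1"
    and int: "set_integrable lborel {0..1} f"
  shows set_integrable_periodic_shift: "set_integrable lborel {0..1} (\<lambda>x. f (x - a))"
    and set_integral_periodic_shift_integrable:
      "(LINT x:{0..1}|lborel. f (x - a)) = (LINT x:{0..1}|lborel. f x)"
proof -
  define A B where "A = {0..1-a}" and "B = {1-a..1}"
  have iA: "set_integrable lborel A f" and iB: "set_integrable lborel B f"
    using int a by (auto intro: set_integrable_subset simp: A_def B_def)
  have indA: "indicator {a..1} x *\<^sub>R f (x - a) = indicator A (-a + 1 * x) *\<^sub>R f (-a + 1 * x)" for x
    by (auto simp: indicator_def A_def)
  have indB: "indicator {0..a} x *\<^sub>R f (x - a) = indicator B ((1-a) + 1 * x) *\<^sub>R f ((1-a) + 1 * x)" for x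
    using per[of "x - a"] by (auto simp: indicator_def B_def algebra_simps)
  have iA': "set_integrable lborel {a..1} (\<lambda>x. f (x - a))"
    unfolding set_integrable_def indA
    using iA unfolding set_integrable_def by (rule lborel_integrable_real_affine) simp
  have iB': "set_integrable lborel {0..a} (\<lambda>x. f (x - a))"
    unfolding set_integrable_def indB
    using iB unfolding set_integrable_def by (rule lborel_integrable_real_affine) simp
  have eA: "(LINT x:{a..1}|lborel. f (x - a)) = (LINT x:A|lborel. f x)"
    unfolding set_lebesgue_integral_def indA
    by (subst (2) lborel_integral_real_affine[where c = 1 and t = "-a"]) auto
  have eB: "(LINT x:{0..a}|lborel. f (x - a)) = (LINT x:B|lborel. f x)"
    unfolding set_lebesgue_integral_def indB
    by (subst (2) lborel_integral_real_affine[where c = 1 and t = "1-a"]) auto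
  have split: "{0..1} = {0..a} \<union> {a..1}"
    using a by auto
  show "set_integrable lborel {0..1} (\<lambda>x. f (x - a))"
    unfolding split by (intro set_integrable_Un iA' iB') auto
  have "(LINT x:{0..1}|lborel. f (x - a)) = (LINT x:{0..a} \<union> {a..1}|lborel. f (x - a))"
    by (simp only: split)
  also have "\<dots> = (LINT x:{0..a}|lborel. f (x - a)) + (LINT x:{a..1}|lborel. f (x - a))"
    using AE_lborel_singleton[of a] by (intro set_integral_Un_AE iA' iB') auto
  also have "\<dots> = (LINT x:A|lborel. f x) + (LINT x:B|lborel. f x)"
    using eA eB by simp
  also have "\<dots> = (LINT x:A \<union> B|lborel. f x)"
    using AE_lborel_singleton[of "1 - a"]
    by (intro set_integral_Un_AE[symmetric] iA iB) (auto simp: A_def B_def)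
  also have "A \<union> B = {0..1}"
    using a by (auto simp: A_def B_def)
  finally show "(LINT x:{0..1}|lborel. f (x - a)) = (LINT x:{0..1}|lborel. f x)" .
qed

text \<open>If \<open>f\<close> is not integrable, neither is its shift, since a further shift by
  \<open>1 - a\<close> restores \<open>f\<close>; both integrals are then 0 by convention. Without
  an integrability hypothesis the rule applies to every slice of a function on the torus, although
  Fubini makes only almost all slices integrable.\<close>

lemma set_integral_periodic_shift:
  fixes f :: "real \<Rightarrow> 'a :: {banach, second_countable_topology}"
  assumes per: "\<And>x. f (x + 1) = f x" and a: "0 \<le> a" "a \<le> 1"
  shows "(LINT x:{0..1}|lborel. f (x - a)) = (LINT x:{0..1}|lborel. f x)"
proof (cases "set_integrable lborel {0..1} f")
  case True
  then show ?thesis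
    by (intro set_integral_periodic_shift_integrable per a)
next
  case False
  have "\<not> set_integrable lborel {0..1} (\<lambda>x. f (x - a))"
  proof
    assume "set_integrable lborel {0..1} (\<lambda>x. f (x - a))"
    moreover have "f (x + 1 - a) = f (x - a)" for x
      using per[of "x - a"] by (simp add: algebra_simps)
    ultimately have "set_integrable lborel {0..1} (\<lambda>x. f (x - (1 - a) - a))"
      using a by (intro set_integrable_periodic_shift[where f = "\<lambda>x. f (x - a)"]) auto
    moreover have "f (x - (1 - a) - a) = f x" for x
      using per[of "x - 1"] by simp
    ultimately show False using False by simp
  qed
  with False show ?thesis
    by (simp add: set_integrable_def set_lebesgue_integral_def not_integrable_integral_eq)
qed

text \<open>The substitution x to 1 - x preserves [0, 1], and the period removes the 1.\<close>

lemma set_integral_periodic_reflect: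
  fixes f :: "real \<Rightarrow> 'a :: {banach, second_countable_topology}"
  assumes per: "\<And>x. f (x + 1) = f x"
  shows "(LINT x:{0..1}|lborel. f (- x)) = (LINT x:{0..1}|lborel. f x)"
proof -
  have "indicator {0..1} (1 + (-1) * x) *\<^sub>R f (1 + (-1) * x) = indicator {0..1} x *\<^sub>R f (- x)" for x
    using per[of "-x"] by (auto simp: indicator_def)
  then show ?thesis
    unfolding set_lebesgue_integral_def
    by (subst (2) lborel_integral_real_affine[where c = "-1" and t = 1]) auto
qed

section \<open>A lower bound for |1 + z + w| on the torus\<close>

text \<open>The bound 2/3 is the largest distance from a point of [0, 1] to 1/3 or 2/3. Up to 1/3
  the cosine is at least 1/2, so the mean value theorem gives slope at least pi/2 \<ge> 1. Between
  1/3 and 2/3 the sine is at least sin(pi/3) \<ge> 2/3.\<close>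

lemma abs_sin_pi_ge:
  assumes "\<bar>x\<bar> \<le> 2/3"
  shows "\<bar>x\<bar> \<le> \<bar>sin (pi * x)\<bar>"
proof -
  have *: "y \<le> sin (pi * y)" if y: "0 \<le> y" "y \<le> 2/3" for y :: real
  proof (cases "y \<le> 1/3")
    case True
    show ?thesis
    proof (cases "y = 0")
      case False
      then have "0 < pi * y" using y by simp
      then obtain z where z: "0 < z" "z < pi * y" "sin (pi * y) - sin 0 = (pi * y - 0) * cos z"
        using MVT2[of 0 "pi * y" sin cos] by (auto intro: DERIV_sin)
      have "pi * y \<le> pi / 3" using True by simp
      then have "cos (pi / 3) \<le> cos z"
        using z by (intro cos_monotone_0_pi_le) (linarith | simp)+
      then have "pi * y * (1 / 2) \<le> sin (pi * y)"
        using z(3) mult_left_mono[of "1/2" "cos z" "pi * y"] \<open>0 < pi * y\<close>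
        by (simp add: cos_60)
      moreover have "2 * y \<le> pi * y"
        using y pi_ge_two by (intro mult_right_mono) auto
      ultimately show ?thesis by linarith
    qed simp
  next
    case False
    have "(4/3)\<^sup>2 \<le> (3::real)" by (simp add: power2_eq_square)
    then have "4/3 \<le> sqrt 3" by (rule real_le_rsqrt)
    then have "2/3 \<le> sin (pi / 3)" by (simp add: sin_60)
    also have "\<dots> \<le> sin (pi * y)"
    proof (cases "y \<le> 1/2")
      case True
      then show ?thesis
        using False by (intro sin_monotone_2pi_le) (auto simp: field_simps)
    next
      case 2: False
      have "sin (pi / 3) \<le> sin (pi * (1 - y))"
        using 2 y by (intro sin_monotone_2pi_le) (auto simp: field_simps)
      also have "\<dots> = sin (pi * y)"
        using sin_pi_minus[of "pi * y"] by (simp add: algebra_simps)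
      finally show ?thesis .
    qed
    finally show ?thesis using y by linarith
  qed
  show ?thesis
    using *[of "\<bar>x\<bar>"] assms by (cases "x \<ge> 0") auto
qed

definition unit_circle :: "real \<Rightarrow> complex" where
  "unit_circle t = cis (2 * pi * t)"

lemma unit_circle_add: "unit_circle (a + b) = unit_circle a * unit_circle b"
  by (simp add: unit_circle_def cis_mult algebra_simps)

lemma unit_circle_diff: "unit_circle (a - b) = unit_circle a / unit_circle b"
  by (simp add: unit_circle_def cis_divide algebra_simps)

lemma unit_circle_1 [simp]: "unit_circle 1 = 1"
  by (simp add: unit_circle_def)

lemma unit_circle_minus: "unit_circle (- a) = 1 / unit_circle a"
  using unit_circle_diff[of 0 a] by (simp add: unit_circle_def)

lemma unit_circle_neq_0 [simp]: "unit_circle a \<noteq> 0"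
  by (simp add: unit_circle_def)

lemma norm_unit_circle [simp]: "norm (unit_circle a) = 1"
  by (simp add: unit_circle_def)

lemma continuous_on_unit_circle [continuous_intros]:
  "continuous_on S f \<Longrightarrow> continuous_on S (\<lambda>x. unit_circle (f x))"
  unfolding unit_circle_def by (intro continuous_intros)

lemma borel_measurable_unit_circle [measurable]: "unit_circle \<in> borel_measurable borel"
  by (intro borel_measurable_continuous_onI continuous_intros)

lemma exp_eq_unit_circle: "exp (2 * of_real pi * \<i> * of_real t) = unit_circle t"
  by (simp add: unit_circle_def cis_conv_exp mult_ac)

text \<open>With r = |1 + z|, the reverse triangle inequality leaves |r - 1| to be bounded below.
  Passing to r^2 - 1 = 1 + 2 cos(2 pi t) makes the zeros 1/3 and 2/3 explicit as a product of two
  sines.\<close>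

lemma norm_one_plus_circle_ge:
  assumes t: "0 \<le> t" "t \<le> 1" and w: "norm w = 1"
  shows "\<bar>t - 1/3\<bar> * \<bar>t - 2/3\<bar> \<le> norm (1 + unit_circle t + w)"
proof -
  define r where "r = norm (1 + unit_circle t)"
  have r: "0 \<le> r" "r \<le> 2"
    using norm_triangle_ineq[of 1 "unit_circle t"] by (auto simp: r_def)
  have le: "\<bar>r - 1\<bar> \<le> norm (1 + unit_circle t + w)"
    using norm_triangle_ineq3[of "1 + unit_circle t" "-w"] w by (simp add: r_def)
  have "r\<^sup>2 = (1 + cos (2 * pi * t))\<^sup>2 + (sin (2 * pi * t))\<^sup>2"
    by (simp add: r_def cmod_power2 unit_circle_def)
  also have "\<dots> = ((cos (2 * pi * t))\<^sup>2 + (sin (2 * pi * t))\<^sup>2) + 1 + 2 * cos (2 * pi * t)"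
    by (simp add: power2_sum)
  finally have "\<bar>r\<^sup>2 - 1\<bar> = \<bar>1 + 2 * cos (2 * pi * t)\<bar>"
    by simp
  also have "1 + 2 * cos (2 * pi * t) = 4 * sin (pi * (t - 1/3)) * sin (pi * (t - 2/3))"
  proof -
    have eq: "pi * (t - 1/3) - pi * (t - 2/3) = pi / 3" "pi * (t - 1/3) + pi * (t - 2/3) = 2 * pi * t - pi"
      by (simp_all add: field_simps)
    have "4 * (sin (pi * (t - 1/3)) * sin (pi * (t - 2/3))) = 2 * (cos (pi / 3) - cos (2 * pi * t - pi))"
      unfolding sin_times_sin eq by simp
    also have "\<dots> = 1 + 2 * cos (2 * pi * t)"
      unfolding cos_60 cos_diff by simp
    finally show ?thesis by simp
  qed
  also have "\<bar>\<dots>\<bar> = 4 * (\<bar>sin (pi * (t - 1/3))\<bar> * \<bar>sin (pi * (t - 2/3))\<bar>)"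
    by (simp only: abs_mult abs_numeral mult.assoc)
  finally have "\<bar>r\<^sup>2 - 1\<bar> = 4 * (\<bar>sin (pi * (t - 1/3))\<bar> * \<bar>sin (pi * (t - 2/3))\<bar>)" .
  moreover have "\<bar>t - 1/3\<bar> * \<bar>t - 2/3\<bar> \<le> \<bar>sin (pi * (t - 1/3))\<bar> * \<bar>sin (pi * (t - 2/3))\<bar>"
    using t by (intro mult_mono abs_sin_pi_ge) (auto simp: abs_le_iff field_simps)
  \<comment> \<open>The true factor r + 1 is at most 3; 4 is taken because it cancels the 4 in front
    of the sines.\<close>
  moreover have "\<bar>r\<^sup>2 - 1\<bar> \<le> \<bar>r - 1\<bar> * 4"
  proof -
    have "r\<^sup>2 - 1 = (r - 1) * (r + 1)"
      by (simp add: power2_eq_square algebra_simps)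
    then have "\<bar>r\<^sup>2 - 1\<bar> = \<bar>r - 1\<bar> * \<bar>r + 1\<bar>"
      by (simp only: abs_mult)
    also have "\<dots> \<le> \<bar>r - 1\<bar> * 4"
      using r by (intro mult_left_mono) auto
    finally show ?thesis .
  qed
  ultimately show ?thesis
    using le by linarith
qed

section \<open>Domination by a product of functions of one variable\<close>

text \<open>The root comes from the geometric mean and makes the singularities integrable. At 1/3
  and 2/3 the value is 0, by \<open>1 / 0 = 0\<close>.\<close>

definition slice_bound :: "real \<Rightarrow> real" where
  "slice_bound t = 1 / sqrt (\<bar>t - 1/3\<bar> * \<bar>t - 2/3\<bar>)"

lemma borel_measurable_slice_bound [measurable]: "slice_bound \<in> borel_measurable borel"
  unfolding slice_bound_def by measurable

lemma slice_bound_integrable: "set_integrable lborel {0..1} slice_bound"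
proof (rule set_integrable_bound)
  show "set_integrable lborel {0..1} (\<lambda>x. sqrt 6 * (1 / sqrt \<bar>x - 1/3\<bar> + 1 / sqrt \<bar>x - 2/3\<bar>))"
    by (intro set_integrable_mult_right set_integral_add integrable_inverse_sqrt_dist) auto
  show "set_borel_measurable lborel {0..1} slice_bound"
    unfolding set_borel_measurable_def by measurable
  \<comment> \<open>The points 1/3 and 2/3 are 1/3 apart, so one of the two distances is at least
    1/6 and its inverse root at most \<open>sqrt 6\<close>. Hence only one factor is singular at a
    time.\<close>
  have *: "1 / sqrt (u * v) \<le> sqrt 6 * (1 / sqrt u + 1 / sqrt v)"
    if uv: "0 \<le> u" "1/6 \<le> v" for u v :: real
  proof -
    have "1 / sqrt v \<le> 1 / sqrt (1/6)"
      using uv by (intro divide_left_mono) auto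
    also have "\<dots> = sqrt 6"
      by (simp add: real_sqrt_divide)
    finally have "1 / sqrt u * (1 / sqrt v) \<le> 1 / sqrt u * sqrt 6"
      using uv by (intro mult_left_mono) auto
    moreover have "0 \<le> sqrt 6 * (1 / sqrt v)" using uv by simp
    ultimately show ?thesis by (simp add: real_sqrt_mult algebra_simps)
  qed
  have "norm (slice_bound x) \<le> norm (sqrt 6 * (1 / sqrt \<bar>x - 1/3\<bar> + 1 / sqrt \<bar>x - 2/3\<bar>))" for x
  proof -
    have "1/6 \<le> \<bar>x - 1/3\<bar> \<or> 1/6 \<le> \<bar>x - 2/3\<bar>" by linarith
    then have "slice_bound x \<le> sqrt 6 * (1 / sqrt \<bar>x - 1/3\<bar> + 1 / sqrt \<bar>x - 2/3\<bar>)"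
      using *[of "\<bar>x - 1/3\<bar>" "\<bar>x - 2/3\<bar>"] *[of "\<bar>x - 2/3\<bar>" "\<bar>x - 1/3\<bar>"]
      by (auto simp: slice_bound_def mult.commute add.commute)
    then show ?thesis by (simp add: slice_bound_def abs_mult)
  qed
  then show "AE x in lborel. x \<in> {0..1} \<longrightarrow>
      norm (slice_bound x) \<le> norm (sqrt 6 * (1 / sqrt \<bar>x - 1/3\<bar> + 1 / sqrt \<bar>x - 2/3\<bar>))"
    by simp
qed

text \<open>The points 1/3 and 2/3 are excluded because \<open>slice_bound\<close> takes the value 0
  there.\<close>

lemma inverse_circle_sum_le:
  assumes "t \<in> {0..1}" "s \<in> {0..1}"
    and "t \<notin> {1/3, 2/3}" "s \<notin> {1/3, 2/3}"
  shows "1 / norm (1 + unit_circle t + unit_circle s) \<le> slice_bound t * slice_bound s"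
proof -
  define d where "d = norm (1 + unit_circle t + unit_circle s)"
  define u where "u = \<bar>t - 1/3\<bar> * \<bar>t - 2/3\<bar>"
  define v where "v = \<bar>s - 1/3\<bar> * \<bar>s - 2/3\<bar>"
  have uv: "0 < u" "0 < v"
    using assms by (auto simp: u_def v_def)
  have "u \<le> d" "v \<le> d"
    using norm_one_plus_circle_ge[of t "unit_circle s"] norm_one_plus_circle_ge[of s "unit_circle t"] assms
    by (auto simp: u_def v_def d_def add_ac)
  then have "sqrt u * sqrt v \<le> sqrt d * sqrt d"
    using uv by (intro mult_mono) auto
  then have "sqrt u * sqrt v \<le> d" using uv \<open>u \<le> d\<close> by simp
  then have "1 / d \<le> 1 / (sqrt u * sqrt v)"
    using uv \<open>u \<le> d\<close> by (intro divide_left_mono mult_pos_pos) auto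
  then show ?thesis
    by (simp add: d_def[symmetric] slice_bound_def real_sqrt_mult u_def v_def mult_ac)
qed

text \<open>Off these four lines the lower bound for |1 + z + w| is positive, so the denominator
  does not vanish.\<close>

lemma AE_torus_regular:
  "AE z in lborel \<Otimes>\<^sub>M lborel. fst z \<notin> {1/3, 2/3 :: real} \<and> snd z \<notin> {1/3, 2/3 :: real}"
proof (rule lborel_pair.AE_pair_measure)
  have ae: "AE t in lborel. t \<notin> {1/3, 2/3 :: real}"
    using AE_lborel_singleton[of "1/3"] AE_lborel_singleton[of "2/3"] by auto
  show "AE x in lborel. AE y in lborel. fst (x, y) \<notin> {1/3, 2/3 :: real} \<and> snd (x, y) \<notin> {1/3, 2/3 :: real}"
    using ae
  proof eventually_elim
    case (elim x)
    show ?case using ae by eventually_elim (use elim in auto)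
  qed
qed measurable

lemma slice_bound_product_integrable:
  "set_integrable (lborel \<Otimes>\<^sub>M lborel) ({0..1} \<times> {0..1}) (\<lambda>z. slice_bound (fst z) * slice_bound (snd z))"
proof -
  define g where "g x = indicator {0..1} x *\<^sub>R slice_bound x" for x
  have [measurable]: "g \<in> borel_measurable borel"
    unfolding g_def by measurable
  have g: "integrable lborel g" "\<And>x. 0 \<le> g x"
    using slice_bound_integrable by (auto simp: set_integrable_def g_def[abs_def] slice_bound_def)
  have "integrable (lborel \<Otimes>\<^sub>M lborel) (\<lambda>z. g (fst z) * g (snd z))"
  proof (rule lborel_pair.Fubini_integrable)
    show "integrable lborel (\<lambda>x. \<integral>y. norm (g (fst (x, y)) * g (snd (x, y))) \<partial>lborel)"
      using g by (simp add: abs_mult)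
  qed (use g in auto)
  then show ?thesis
    by (simp add: set_integrable_def g_def indicator_times mult_ac)
qed

section \<open>Integration on the torus and its symmetries\<close>

abbreviation torus_integrable :: "(real \<times> real \<Rightarrow> complex) \<Rightarrow> bool" where
  "torus_integrable \<equiv> set_integrable (lborel \<Otimes>\<^sub>M lborel) ({0..1} \<times> {0..1})"

abbreviation torus_integral :: "(real \<times> real \<Rightarrow> complex) \<Rightarrow> complex" where
  "torus_integral \<equiv> set_lebesgue_integral (lborel \<Otimes>\<^sub>M lborel) ({0..1} \<times> {0..1})"

text \<open>A numerator of modulus 1 covers 1, z and w at once.\<close>

lemma torus_integrable_circle_quotient:
  assumes [measurable]: "f \<in> borel_measurable (lborel \<Otimes>\<^sub>M lborel)"
    and f: "\<And>z. norm (f z) = 1"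
  shows "torus_integrable (\<lambda>z. f z / (1 + unit_circle (fst z) + unit_circle (snd z)))"
proof (rule set_integrable_bound[OF slice_bound_product_integrable])
  show "set_borel_measurable (lborel \<Otimes>\<^sub>M lborel) ({0..1} \<times> {0..1})
      (\<lambda>z. f z / (1 + unit_circle (fst z) + unit_circle (snd z)))"
    unfolding set_borel_measurable_def by measurable
  show "AE z in lborel \<Otimes>\<^sub>M lborel. z \<in> {0..1} \<times> {0..1} \<longrightarrow>
      norm (f z / (1 + unit_circle (fst z) + unit_circle (snd z)))
        \<le> norm (slice_bound (fst z) * slice_bound (snd z))"
    using AE_torus_regular
  proof eventually_elim
    case (elim z)
    then show ?case
      using inverse_circle_sum_le[of "fst z" "snd z"] f[of z]
      by (auto simp: norm_divide intro: order_trans)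
  qed
qed

lemma torus_integral_iterated:
  assumes "torus_integrable f"
  shows "torus_integral f = (LINT t:{0..1}|lborel. LINT s:{0..1}|lborel. f (t, s))"
proof -
  define F where "F = (\<lambda>z. indicator ({0..1} \<times> {0..1}) z *\<^sub>R f z)"
  have F: "integrable (lborel \<Otimes>\<^sub>M lborel) F"
    using assms by (simp add: set_integrable_def F_def)
  have Fts: "F (t, s) = indicator {0..1} t *\<^sub>R (indicator {0..1} s *\<^sub>R f (t, s))" for t s
    by (simp add: F_def indicator_times)
  show ?thesis
    using lborel_pair.integral_fst'[OF F] unfolding Fts
    by (simp add: set_lebesgue_integral_def F_def del: scaleR_scaleR)
qed

lemma torus_integral_swap:
  assumes "torus_integrable f"
  shows "torus_integral (\<lambda>z. f (snd z, fst z)) = torus_integral f"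
proof -
  define F where "F = (\<lambda>z. indicator ({0..1} \<times> {0..1}) z *\<^sub>R f z)"
  have F: "F \<in> borel_measurable (lborel \<Otimes>\<^sub>M lborel)"
    using assms unfolding set_integrable_def F_def by (rule borel_measurable_integrable)
  have "indicator ({0..1} \<times> {0..1}) z *\<^sub>R f (snd z, fst z) = (case z of (x, y) \<Rightarrow> F (y, x))" for z
    by (auto simp: F_def indicator_def split: prod.splits)
  then show ?thesis
    using lborel_pair.integral_product_swap[OF F]
    by (simp add: set_lebesgue_integral_def F_def)
qed

text \<open>The substitution is the automorphism \<open>(z, w) \<mapsto> (1 / z, w / z)\<close> of the torus.\<close>

lemma torus_integral_automorphism:
  assumes f: "torus_integrable f" and g: "torus_integrable (\<lambda>z. f (- fst z, snd z - fst z))"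
    and per1: "\<And>t s. f (t + 1, s) = f (t, s)" and per2: "\<And>t s. f (t, s + 1) = f (t, s)"
  shows "torus_integral (\<lambda>z. f (- fst z, snd z - fst z)) = torus_integral f"
proof -
  define k where "k t = (LINT s:{0..1}|lborel. f (t, s))" for t
  have k: "k (t + 1) = k t" for t
    by (simp add: k_def per1)
  have "torus_integral (\<lambda>z. f (- fst z, snd z - fst z)) =
      (LINT t:{0..1}|lborel. LINT s:{0..1}|lborel. f (- t, s - t))"
    using torus_integral_iterated[OF g] by simp
  \<comment> \<open>For fixed \<open>t\<close> in [0, 1] the inner variable is shifted by
    \<open>t\<close>, which does not change an integral over a full period.\<close>
  also have "\<dots> = (LINT t:{0..1}|lborel. k (- t))"
    unfolding k_def by (intro set_lebesgue_integral_cong set_integral_periodic_shift allI impI)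
      (auto simp: per2)
  also have "\<dots> = (LINT t:{0..1}|lborel. k t)"
    by (intro set_integral_periodic_reflect k)
  also have "\<dots> = torus_integral f"
    using torus_integral_iterated[OF f] by (simp add: k_def)
  finally show ?thesis .
qed

section \<open>The value 1/3\<close>

lemma torus_integral_circle_quotient:
  "torus_integral (\<lambda>z. unit_circle (snd z) / (1 + unit_circle (fst z) + unit_circle (snd z))) = 1 / 3"
proof -
  define D where "D z = 1 + unit_circle (fst z) + unit_circle (snd z)" for z
  define U V W where "U z = 1 / D z" and "V z = unit_circle (fst z) / D z"
    and "W z = unit_circle (snd z) / D z" for z
  have U: "torus_integrable U" and V: "torus_integrable V" and W: "torus_integrable W"
    unfolding U_def[abs_def] V_def[abs_def] W_def[abs_def] D_def
    by (intro torus_integrable_circle_quotient; simp)+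
  \<comment> \<open>Under the automorphism the denominator becomes 1 + 1/z + w/z = (1 + z + w)/z,
    and the numerator z becomes 1/z, so the factor 1/z cancels.\<close>
  have UV: "V (- fst z, snd z - fst z) = U z" for z
  proof -
    have "D (- fst z, snd z - fst z) = D z / unit_circle (fst z)"
      by (simp add: D_def unit_circle_minus unit_circle_diff field_simps)
    then show ?thesis
      by (simp add: U_def V_def unit_circle_minus)
  qed
  have "torus_integral U = torus_integral V"
    using torus_integral_automorphism[OF V] U
    by (simp add: UV) (simp add: V_def D_def unit_circle_add)
  moreover have "torus_integral V = torus_integral W"
    using torus_integral_swap[OF W] by (simp add: V_def[abs_def] W_def D_def add_ac)
  moreover have "torus_integral (\<lambda>z. U z + V z + W z) = torus_integral U + torus_integral V + torus_integral W"
    using U V W by (simp add: set_integral_add)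
  \<comment> \<open>The sum is 1 only almost everywhere: at a zero of \<open>D\<close> all three
    quotients are 0 by convention.\<close>
  moreover have "torus_integral (\<lambda>z. U z + V z + W z) = torus_integral (\<lambda>z. 1)"
  proof -
    have [measurable]: "U \<in> borel_measurable (lborel \<Otimes>\<^sub>M lborel)"
      "V \<in> borel_measurable (lborel \<Otimes>\<^sub>M lborel)" "W \<in> borel_measurable (lborel \<Otimes>\<^sub>M lborel)"
      unfolding U_def[abs_def] V_def[abs_def] W_def[abs_def] D_def by measurable
    have "AE z in lborel \<Otimes>\<^sub>M lborel. z \<in> {0..1} \<times> {0..1} \<longrightarrow> U z + V z + W z = 1"
      using AE_torus_regular
    proof eventually_elim
      case (elim z)
      show ?case
      proof
        assume "z \<in> {0..1} \<times> {0..1}"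
        then have "\<bar>fst z - 1/3\<bar> * \<bar>fst z - 2/3\<bar> \<le> norm (D z)"
          unfolding D_def by (intro norm_one_plus_circle_ge) auto
        then have "D z \<noteq> 0"
          using elim by (auto simp: mult_le_0_iff)
        then show "U z + V z + W z = 1"
          unfolding U_def V_def W_def by (simp add: D_def flip: add_divide_distrib)
      qed
    qed
    then show ?thesis
      by (intro set_lebesgue_integral_cong_AE) auto
  qed
  moreover have "torus_integral (\<lambda>z. 1) = 1"
    by (simp add: set_lebesgue_integral_def measure_def lborel.emeasure_pair_measure_Times)
  ultimately have "torus_integral W = 1 / 3"
    by (simp add: eq_divide_eq mult.commute)
  then show ?thesis
    by (simp only: W_def[abs_def] D_def)
qed

theorem corollary1p2: "alt_mahler (1 + poly_x + poly_y) = 1 / 3"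
proof -
  have deg: "degree (1 + poly_x + poly_y) = 1"
    by (simp add: poly_x_def poly_y_def one_pCons)
  have pd: "pderiv (1 + poly_x + poly_y) = 1"
    by (simp add: poly_x_def poly_y_def one_pCons pderiv_pCons)
  have "alt_mahler_integrand (1 + poly_x + poly_y) =
      (\<lambda>z. unit_circle (snd z) / (1 + unit_circle (fst z) + unit_circle (snd z)))"
    by (auto simp: alt_mahler_integrand_def pd exp_eq_unit_circle fun_eq_iff)
  \<comment> \<open>\<open>lborel_prod\<close> identifies the product measure with
    \<open>lborel\<close> on pairs, over which \<open>alt_mahler\<close> integrates.\<close>
  then show ?thesis
    using torus_integral_circle_quotient by (simp add: alt_mahler_def deg lborel_prod)
qed

end
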